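(* Let $d,N\ge 1$ be integers, let $\mathbb{X}\subset\mathbb{R}^d$ be an open convex set, and let $F:\mathbb{X}\to\mathbb{R}$ be a strictly convex differentiable function whose gradient map $\nabla F:\mathbb{X}\to\mathbb{Y}$ is a homeomorphism onto an open convex set $\mathbb{Y}\subset\mathbb{R}^d$. Let $W=(w_{ij})$ be a real $N\times N$ matrix with $w_{ij}>0$ for all $i,j$ and $\sum_{j=1}^N w_{ij}=1$ for all $i$. Let $\bm{x}_1,\dots,\bm{x}_N\in\mathbb{X}$, put $\bm{x}_i^{(0)}=\bm{x}_i$ for $i=1,\dots,N$, and for $k=0,1,2,\dots$ and $i=1,\dots,N$ define $$\bm{x}_i^{(k+1)}=\arg\min_{\bm{x}\in\mathbb{X}}\sum_{j=1}^N w_{ij}\,D_F\big(\bm{x},\bm{x}_j^{(k)}\big),$$ where $D_F$ is the Bregman divergence of $F$. Then there is a unique row vector $\pi=(\pi_1,\dots,\pi_N)$ satisfying $$\pi W=\pi,\qquad \sum_{j=1}^N\pi_j=1,\qquad \pi_j>0\ \text{ for all } j$$ (the stationary distribution of $W$), and all the sequences $(\bm{x}_i^{(k)})_{k\ge 0}$ converge to one and the same limit (the unique consensus view) $\bar{\bm{x}}\in\mathbb{X}$: for every $i=1,\dots,N$, $$\lim_{k\to\infty}\bm{x}_i^{(k)}=\bar{\bm{x}}=(\nabla F)^{-1}\Big(\sum_{j=1}^N\pi_j\,\nabla F(\bm{x}_j)\Big).$$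
   Context: The Bregman divergence associated with $F$ is, for $\bm{x},\bm{x}'\in\mathbb{X}$, $$D_F(\bm{x},\bm{x}')=F(\bm{x})-F(\bm{x}')-\langle \bm{x}-\bm{x}',\nabla F(\bm{x}')\rangle ,$$ where $\langle\cdot,\cdot\rangle$ is the standard inner product on $\mathbb{R}^d$. For vectors $\bm{x}_1,\dots,\bm{x}_N\in\mathbb{X}$ and positive weights $w_1,\dots,w_N$ with $\sum_i w_i=1$, the (left) Bregman barycenter is $\arg\min_{\bm{x}\in\mathbb{X}}\sum_{i=1}^N w_i D_F(\bm{x},\bm{x}_i)$. Under the stated assumptions on $F$ this minimiser exists and is unique, so the iteration in the claim is well defined. Interpretation: $\bm{x}_i^{(k)}$ is the view of agent $i$ after $k$ rounds, and $w_{ij}$ is the confidence agent $i$ has in agent $j$. In each round all agents simultaneously replace their views by the barycenter of all current views, agent $i$ using the weights in the $i$-th row of $W$ (a "centripetal" agent). The inverse of the gradient map is denoted $(\nabla F)^{-1}:\mathbb{Y}\to\mathbb{X}$. *)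

theory Defs
  imports "HOL-Analysis.Analysis"
begin

definition strictly_convex_on :: "'a::real_vector set \<Rightarrow> ('a \<Rightarrow> real) \<Rightarrow> bool" where
  "strictly_convex_on S f \<longleftrightarrow> convex S \<and>
     (\<forall>x\<in>S. \<forall>y\<in>S. \<forall>u>0. \<forall>v>0. x \<noteq> y \<longrightarrow> u + v = 1 \<longrightarrow>
        f (u *\<^sub>R x + v *\<^sub>R y) < u * f x + v * f y)"

definition grad :: "('a::real_inner \<Rightarrow> real) \<Rightarrow> 'a \<Rightarrow> 'a" where
  "grad f x = (THE D. GDERIV f x :> D)"

definition bregman :: "('a::real_inner \<Rightarrow> real) \<Rightarrow> 'a \<Rightarrow> 'a \<Rightarrow> real" where
  "bregman F x x' = F x - F x' - (x - x') \<bullet> grad F x'"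

(* arg_min_on makes a choice only among minimisers; the minimum over X exists and is unique
   for positive weights of total 1 when grad F is a bijection from X onto a convex set. *)
definition bregman_barycenter ::
    "'a::real_inner set \<Rightarrow> ('a \<Rightarrow> real) \<Rightarrow> ('n::finite \<Rightarrow> real) \<Rightarrow> ('n \<Rightarrow> 'a) \<Rightarrow> 'a" where
  "bregman_barycenter X F w p = arg_min_on (\<lambda>x. \<Sum>j\<in>UNIV. w j * bregman F x (p j)) X"

primrec view ::
    "'a::real_inner set \<Rightarrow> ('a \<Rightarrow> real) \<Rightarrow> real^'n^'n \<Rightarrow> ('n::finite \<Rightarrow> 'a) \<Rightarrow> nat \<Rightarrow> 'n \<Rightarrow> 'a" where
  "view X F W p 0 = p"
| "view X F W p (Suc k) = (\<lambda>i. bregman_barycenter X F (\<lambda>j. W $ i $ j) (view X F W p k))"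

definition stationary_distribution :: "real^'n^'n \<Rightarrow> real^'n \<Rightarrow> bool" where
  "stationary_distribution W \<pi> \<longleftrightarrow>
     \<pi> v* W = \<pi> \<and> (\<Sum>j\<in>UNIV. \<pi> $ j) = 1 \<and> (\<forall>j. \<pi> $ j > 0)"

end

theory Submission
  imports Defs
begin

text \<open>
  The gradient of a Bregman barycenter is the weighted mean of the gradients of the points, so in
  the coordinates \<open>y = \<nabla>F(x)\<close> each round of the iteration is multiplication by \<open>W\<close>. Since all
  entries of \<open>W\<close> exceed some \<open>\<delta> > 0\<close>, multiplication by \<open>W\<close> contracts the oscillation
  \<open>max u - min u\<close> of a vector by the factor \<open>1 - \<delta>\<close>, so \<open>W\<^sup>k u\<close> tends to a constant vector. The
  value \<open>L u\<close> of this constant is a positive linear functional of \<open>u\<close>; its coefficients are the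
  stationary distribution. Continuity of \<open>(\<nabla>F)\<^sup>-\<^sup>1\<close> transports the limit back.
\<close>

section \<open>Positive row-stochastic matrices\<close>

text \<open>The entry of \<open>W *v u\<close> minus \<open>a\<close> is a sum of nonnegative terms,
  of which only term \<open>k\<close> is kept. The index \<open>k\<close> is free, so that it can
  later be chosen where \<open>u\<close> attains its minimum or maximum.\<close>

lemma row_stochastic_mult_bounds:
  fixes W :: "real^'n^'n" and u :: "real^'n"
  assumes W: "\<And>i j. W $ i $ j \<ge> \<delta>" "\<delta> \<ge> 0" "\<And>i. (\<Sum>j\<in>UNIV. W $ i $ j) = 1"
    and u: "\<And>j. a \<le> u $ j" "\<And>j. u $ j \<le> b"
  shows "(W *v u) $ i \<ge> a + \<delta> * (u $ k - a)"
    and "(W *v u) $ i \<le> b - \<delta> * (b - u $ k)"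
proof -
  have "(W *v u) $ i - a = (\<Sum>j\<in>UNIV. W $ i $ j * (u $ j - a))"
    using W(3)[of i]
    by (simp add: matrix_vector_mult_def right_diff_distrib sum_subtractf flip: sum_distrib_right)
  also have "\<dots> \<ge> W $ i $ k * (u $ k - a)"
    using W u by (intro member_le_sum mult_nonneg_nonneg) (auto intro: order_trans)
  also have "W $ i $ k * (u $ k - a) \<ge> \<delta> * (u $ k - a)"
    using W u by (intro mult_right_mono) auto
  finally show "(W *v u) $ i \<ge> a + \<delta> * (u $ k - a)" by simp
  have "b - (W *v u) $ i = (\<Sum>j\<in>UNIV. W $ i $ j * (b - u $ j))"
    using W(3)[of i]
    by (simp add: matrix_vector_mult_def right_diff_distrib sum_subtractf flip: sum_distrib_right)
  also have "\<dots> \<ge> W $ i $ k * (b - u $ k)"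
    using W u by (intro member_le_sum mult_nonneg_nonneg) (auto intro: order_trans)
  also have "W $ i $ k * (b - u $ k) \<ge> \<delta> * (b - u $ k)"
    using W u by (intro mult_right_mono) auto
  finally show "(W *v u) $ i \<le> b - \<delta> * (b - u $ k)" by simp
qed

lemma positive_matrix_lower_bound:
  fixes W :: "real^'n^'m"
  assumes "\<And>i j. W $ i $ j > 0"
  obtains \<delta> where "\<delta> > 0" "\<And>i j. W $ i $ j \<ge> \<delta>"
proof
  let ?A = "range (\<lambda>(i, j). W $ i $ j)"
  show "Min ?A > 0" using assms by (subst Min_gr_iff) auto
  show "Min ?A \<le> W $ i $ j" for i j by (rule Min_le) (auto intro: rev_image_eqI[of "(i, j)"])
qed

text \<open>The smallest entries increase to \<open>c\<close> and the gap to the largest shrinks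
  geometrically, which squeezes every entry to \<open>c\<close>. The second conclusion will give
  strict positivity of the stationary weights.\<close>

lemma positive_row_stochastic_power_tendsto:
  fixes W :: "real^'n^'n" and u :: "real^'n"
  assumes pos: "\<And>i j. W $ i $ j > 0" and stoch: "\<And>i. (\<Sum>j\<in>UNIV. W $ i $ j) = 1"
  obtains c where "\<And>i. (\<lambda>k. ((*v) W ^^ k) u $ i) \<longlonglongrightarrow> c"
    and "\<And>k a. (\<And>i. a \<le> ((*v) W ^^ k) u $ i) \<Longrightarrow> a \<le> c"
proof -
  obtain \<delta> where \<delta>: "\<delta> > 0" "\<And>i j. W $ i $ j \<ge> \<delta>"
    using positive_matrix_lower_bound[of W] pos by blast
  \<comment> \<open>This makes \<open>1 - \<delta>\<close> nonnegative, so the contraction estimate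
    can be iterated. Here \<open>undefined\<close> is just some index.\<close>
  have "\<delta> \<le> 1"
  proof -
    have "W $ undefined $ undefined \<le> (\<Sum>j\<in>UNIV. W $ undefined $ j)"
      using pos by (intro member_le_sum) (auto intro: less_imp_le)
    then show ?thesis using \<delta>(2) stoch by (metis order_trans)
  qed
  define v where "v k = ((*v) W ^^ k) u" for k
  define m M where "m k = Min (range (($) (v k)))" and "M k = Max (range (($) (v k)))" for k
  have v_bounds: "m k \<le> v k $ i" "v k $ i \<le> M k" for k i
    by (simp_all add: m_def M_def)
  have v_attains: "\<exists>i. v k $ i = m k" "\<exists>i. v k $ i = M k" for k
  proof -
    have "m k \<in> range (($) (v k))" "M k \<in> range (($) (v k))"
      unfolding m_def M_def by (simp_all del: Min_in Max_in add: Min_in Max_in)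
    then show "\<exists>i. v k $ i = m k" "\<exists>i. v k $ i = M k" by (auto simp: eq_commute)
  qed
  have v_Suc: "v (Suc k) = W *v v k" for k by (simp add: v_def)
  note step = row_stochastic_mult_bounds[OF \<delta>(2) less_imp_le[OF \<delta>(1)] stoch v_bounds, folded v_Suc]
  have m_step: "m k \<le> m (Suc k)" for k
  proof -
    obtain i where "v (Suc k) $ i = m (Suc k)" using v_attains by blast
    moreover obtain j where "v k $ j = m k" using v_attains by blast
    ultimately show ?thesis using step(1)[of k j i] by simp
  qed
  \<comment> \<open>The upper estimate is applied at an index where the minimum is attained, so
    \<open>b - u $ k\<close> there becomes the full oscillation \<open>M k - m k\<close>.\<close>
  have osc_step: "M (Suc k) - m (Suc k) \<le> (1 - \<delta>) * (M k - m k)" for k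
  proof -
    obtain i where "v (Suc k) $ i = M (Suc k)" using v_attains by blast
    moreover obtain j where "v k $ j = m k" using v_attains by blast
    ultimately have "M (Suc k) \<le> M k - \<delta> * (M k - m k)" using step(2) by metis
    then show ?thesis using m_step[of k] by (simp add: algebra_simps)
  qed
  have osc: "M k - m k \<le> (1 - \<delta>) ^ k * (M 0 - m 0)" for k
  proof (induction k)
    case (Suc k)
    have "M (Suc k) - m (Suc k) \<le> (1 - \<delta>) * ((1 - \<delta>) ^ k * (M 0 - m 0))"
      using order_trans[OF osc_step mult_left_mono[OF Suc]] \<open>\<delta> \<le> 1\<close> by simp
    then show ?case by (simp add: mult.assoc)
  qed simp
  have "incseq m" using m_step by (rule incseq_SucI)
  have M_step: "M (Suc k) \<le> M k" for k
  proof -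
    obtain i where "v (Suc k) $ i = M (Suc k)" using v_attains by blast
    moreover obtain j where "v k $ j = M k" using v_attains by blast
    ultimately show ?thesis using step(2)[of k i j] by simp
  qed
  have "m k \<le> M 0" for k
    using v_bounds[of k undefined] decseqD[OF decseq_SucI[of M, OF M_step], of 0 k] by linarith
  then obtain c where c: "m \<longlonglongrightarrow> c" "\<And>k. m k \<le> c"
    using incseq_convergent[OF \<open>incseq m\<close>] by blast
  have osc_lim: "(\<lambda>k. (1 - \<delta>) ^ k * (M 0 - m 0)) \<longlonglongrightarrow> 0"
    using \<delta>(1) \<open>\<delta> \<le> 1\<close> by (intro tendsto_mult_left_zero LIMSEQ_realpow_zero) auto
  have "(\<lambda>k. v k $ i) \<longlonglongrightarrow> c" for i
  proof (rule tendsto_sandwich[OF _ _ c(1)])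
    show "(\<lambda>k. m k + (1 - \<delta>) ^ k * (M 0 - m 0)) \<longlonglongrightarrow> c"
      using tendsto_add[OF c(1) osc_lim] by simp
    show "\<forall>\<^sub>F k in sequentially. v k $ i \<le> m k + (1 - \<delta>) ^ k * (M 0 - m 0)"
      using v_bounds(2)[of _ i] osc
      by (intro always_eventually allI) (smt (verit))
  qed (simp add: v_bounds)
  \<comment> \<open>Since \<open>m k\<close> is attained, \<open>a\<close> lies below it, and the
    increasing sequence \<open>m\<close> stays below its limit.\<close>
  moreover have "a \<le> c" if "\<And>i. a \<le> v k $ i" for k a
    using that v_attains(1)[of k] c(2)[of k] by (metis order_trans)
  ultimately show thesis by (rule that[unfolded v_def[symmetric]])
qed

section \<open>The stationary distribution and the limit of the iteration\<close>

lemma stationary_distribution_inner_power: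
  assumes "stationary_distribution W \<pi>"
  shows "\<pi> \<bullet> ((*v) W ^^ k) u = \<pi> \<bullet> u"
proof (induction k)
  case (Suc k)
  have "\<pi> \<bullet> ((*v) W ^^ Suc k) u = (\<pi> v* W) \<bullet> ((*v) W ^^ k) u"
    by (simp add: dot_lmul_matrix)
  also have "\<pi> v* W = \<pi>" using assms by (simp add: stationary_distribution_def)
  finally show ?case using Suc by simp
qed simp

text \<open>The inner product with \<open>\<pi>\<close> is invariant under the iteration, while the
  iterates tend to a constant vector, on which a weighted mean of total weight 1 returns the
  constant.\<close>

lemma stationary_distribution_inner_eq_limit:
  assumes \<pi>: "stationary_distribution W \<pi>" and "\<And>i. (\<lambda>k. ((*v) W ^^ k) u $ i) \<longlonglongrightarrow> c"
  shows "\<pi> \<bullet> u = c"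
proof -
  have "(\<lambda>k. \<pi> \<bullet> ((*v) W ^^ k) u) \<longlonglongrightarrow> \<pi> \<bullet> (\<chi> i. c)"
    using assms(2) by (intro tendsto_inner tendsto_const vec_tendstoI) simp
  moreover have "\<pi> \<bullet> (\<chi> i. c) = c"
    using \<pi> by (simp add: inner_vec_def stationary_distribution_def flip: sum_distrib_right)
  ultimately show ?thesis
    unfolding stationary_distribution_inner_power[OF \<pi>]
    by (simp add: tendsto_const_iff)
qed

lemma stationary_distribution_ex1:
  fixes W :: "real^'n^'n"
  assumes pos: "\<And>i j. W $ i $ j > 0" and stoch: "\<And>i. (\<Sum>j\<in>UNIV. W $ i $ j) = 1"
  shows "\<exists>!\<pi>. stationary_distribution W \<pi>"
proof -
  define iter where "iter k u = ((*v) W ^^ k) u" for k and u :: "real^'n"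
  have "\<exists>c. (\<forall>i. (\<lambda>k. iter k u $ i) \<longlonglongrightarrow> c) \<and> (\<forall>k a. (\<forall>i. a \<le> iter k u $ i) \<longrightarrow> a \<le> c)" for u
    using positive_row_stochastic_power_tendsto[of W u] pos stoch unfolding iter_def by metis
  \<comment> \<open>Limits are unique, so the chosen \<open>L\<close> inherits linearity from the
    iteration.\<close>
  then obtain L where L: "\<And>u i. (\<lambda>k. iter k u $ i) \<longlonglongrightarrow> L u"
    and L_ge: "\<And>u k a. (\<And>i. a \<le> iter k u $ i) \<Longrightarrow> a \<le> L u"
    by metis
  have L_eqI: "L u = c" if "\<And>i. (\<lambda>k. iter k u $ i) \<longlonglongrightarrow> c" for u c
    using LIMSEQ_unique[OF L that] .
  have iter_add: "iter k (u + v) = iter k u + iter k v" for k u v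
    by (induction k) (simp_all add: iter_def matrix_vector_right_distrib)
  have iter_scaleR: "iter k (r *\<^sub>R u) = r *\<^sub>R iter k u" for k r u
    by (induction k) (simp_all add: iter_def matrix_vector_mult_scaleR)
  have "linear L"
  proof
    show "L (u + v) = L u + L v" for u v
      by (rule L_eqI) (auto simp: iter_add intro: tendsto_add L)
    show "L (r *\<^sub>R u) = r *\<^sub>R L u" for r u
      by (rule L_eqI) (auto simp: iter_scaleR intro: tendsto_mult L)
  qed
  define \<pi> where "\<pi> = (\<chi> j. L (axis j 1))"
  have L_inner: "L u = \<pi> \<bullet> u" for u
  proof -
    have "L u = L (\<Sum>j\<in>UNIV. u $ j *\<^sub>R axis j 1)"
      by (simp add: basis_expansion flip: scalar_mult_eq_scaleR)
    also have "\<dots> = \<pi> \<bullet> u"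
      using \<open>linear L\<close> by (simp add: linear_sum linear_cmul inner_vec_def \<pi>_def mult.commute)
    finally show ?thesis .
  qed
  \<comment> \<open>Starting from \<open>W *v u\<close> only shifts the sequence by one round. In
    dual form this is \<open>\<pi> v* W = \<pi>\<close>.\<close>
  have "L (W *v u) = L u" for u
  proof (rule L_eqI)
    show "(\<lambda>k. iter k (W *v u) $ i) \<longlonglongrightarrow> L u" for i
      using LIMSEQ_Suc[OF L[of u i]] by (simp add: iter_def funpow_Suc_right del: funpow.simps)
  qed
  then have "(\<pi> v* W) \<bullet> u = \<pi> \<bullet> u" for u
    by (simp add: L_inner dot_lmul_matrix)
  then have "\<pi> v* W = \<pi>" by (metis vector_eq_rdot)
  moreover have "(\<Sum>j\<in>UNIV. \<pi> $ j) = 1"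
  proof -
    have one: "W *v (\<chi> i. 1) = (\<chi> i. 1)"
      by (simp add: vec_eq_iff matrix_vector_mult_def stoch)
    have "iter k (\<chi> i. 1) = (\<chi> i. 1)" for k
      by (induction k) (simp_all add: iter_def one)
    then have "L (\<chi> i. 1) = 1" by (intro L_eqI) simp
    then show ?thesis by (simp add: L_inner inner_vec_def)
  qed
  \<comment> \<open>After one round, \<open>axis j 1\<close> has become column \<open>j\<close> of
    \<open>W\<close>, whose entries are at least \<open>\<delta>\<close>. This bound survives in the
    limit, whereas positivity of the iterates alone would give only a nonnegative limit.\<close>
  moreover have "\<pi> $ j > 0" for j
  proof -
    have "iter 1 (axis j 1) $ i = W $ i $ j" for i
      by (simp add: iter_def matrix_vector_mult_basis column_def)
    moreover obtain \<delta> where \<delta>: "\<delta> > 0" "\<And>i j. W $ i $ j \<ge> \<delta>"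
      using positive_matrix_lower_bound[of W] pos by blast
    ultimately have "\<delta> \<le> L (axis j 1)" using L_ge[of \<delta> 1] by simp
    then show ?thesis using \<delta> by (simp add: \<pi>_def)
  qed
  ultimately have "stationary_distribution W \<pi>"
    by (simp add: stationary_distribution_def)
  \<comment> \<open>Any stationary distribution represents the same functional
    \<open>L\<close>.\<close>
  moreover have "\<rho> = \<pi>" if "stationary_distribution W \<rho>" for \<rho>
  proof -
    have "\<rho> \<bullet> u = \<pi> \<bullet> u" for u
      using stationary_distribution_inner_eq_limit[OF that, of u "L u"] L[of u]
      by (simp add: iter_def L_inner)
    then show ?thesis by (metis vector_eq_rdot)
  qed
  ultimately show ?thesis by blast
qed

text \<open>Inner products with a fixed basis vector turn the vector-valued recursion into powers of
  \<open>W\<close> acting on a real vector.\<close>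

lemma row_stochastic_iteration_tendsto:
  fixes W :: "real^'n^'n" and y :: "nat \<Rightarrow> 'n \<Rightarrow> 'a::euclidean_space"
  assumes pos: "\<And>i j. W $ i $ j > 0" and stoch: "\<And>i. (\<Sum>j\<in>UNIV. W $ i $ j) = 1"
    and y: "\<And>k i. y (Suc k) i = (\<Sum>j\<in>UNIV. W $ i $ j *\<^sub>R y k j)"
    and \<pi>: "stationary_distribution W \<pi>"
  shows "(\<lambda>k. y k i) \<longlonglongrightarrow> (\<Sum>j\<in>UNIV. \<pi> $ j *\<^sub>R y 0 j)"
  unfolding tendsto_componentwise_iff[of "\<lambda>k. y k i"]
proof
  fix b :: 'a
  define u where "u = (\<chi> j. y 0 j \<bullet> b)"
  have iter: "((*v) W ^^ k) u = (\<chi> j. y k j \<bullet> b)" for k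
    by (induction k)
      (simp_all add: u_def vec_eq_iff matrix_vector_mult_def y inner_sum_left)
  obtain c where c: "\<And>i. (\<lambda>k. ((*v) W ^^ k) u $ i) \<longlonglongrightarrow> c"
    using positive_row_stochastic_power_tendsto[of W u] pos stoch by metis
  have "c = (\<Sum>j\<in>UNIV. \<pi> $ j *\<^sub>R y 0 j) \<bullet> b"
    using stationary_distribution_inner_eq_limit[OF \<pi> c]
    by (simp add: u_def inner_vec_def inner_sum_left)
  then show "(\<lambda>k. y k i \<bullet> b) \<longlonglongrightarrow> (\<Sum>j\<in>UNIV. \<pi> $ j *\<^sub>R y 0 j) \<bullet> b"
    using c[of i] by (simp add: iter)
qed

section \<open>Bregman barycenters\<close>

text \<open>The definite description in \<open>grad\<close> is justified here: the gradient is the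
  adjoint of the derivative applied to 1.\<close>

lemma GDERIV_grad:
  fixes f :: "'a::euclidean_space \<Rightarrow> real"
  assumes "f differentiable (at x)"
  shows "GDERIV f x :> grad f x"
proof -
  obtain f' where f': "(f has_derivative f') (at x)"
    using assms by (auto simp: differentiable_def)
  have "f' = (\<lambda>h. h \<bullet> adjoint f' 1)"
    using adjoint_works[OF has_derivative_linear[OF f'], of _ 1] by simp
  with f' have "GDERIV f x :> adjoint f' 1" by (simp add: gderiv_def)
  moreover have "D = adjoint f' 1" if "GDERIV f x :> D" for D
    using has_derivative_unique[OF that[unfolded gderiv_def] \<open>GDERIV f x :> adjoint f' 1\<close>[unfolded gderiv_def]]
    by (metis vector_eq_ldot)
  ultimately show ?thesis unfolding grad_def by (rule theI)
qed

lemma strictly_convex_onD: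
  assumes "strictly_convex_on S f" "x \<in> S" "y \<in> S" "x \<noteq> y" "0 < t" "t < 1"
  shows "f (t *\<^sub>R x + (1 - t) *\<^sub>R y) < t * f x + (1 - t) * f y"
proof -
  have "\<forall>u>0. \<forall>v>0. u + v = 1 \<longrightarrow> f (u *\<^sub>R x + v *\<^sub>R y) < u * f x + v * f y"
    using assms(1-4) unfolding strictly_convex_on_def by blast
  then show ?thesis using assms(5,6) by simp
qed

text \<open>On the segment from \<open>z\<close> to \<open>y\<close>, the function \<open>h\<close>
  compares \<open>F\<close> with its chord and has slope \<open>- bregman F y z\<close> at 0. A
  negative divergence would make \<open>h\<close> rise to the right of 0, but strict convexity keeps
  it below \<open>h 0\<close>.\<close>

lemma bregman_nonneg:
  fixes F :: "'a::euclidean_space \<Rightarrow> real"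
  assumes F: "strictly_convex_on X F" and "F differentiable (at z)" and "y \<in> X" "z \<in> X"
  shows "bregman F y z \<ge> 0"
proof (rule ccontr)
  assume neg: "\<not> bregman F y z \<ge> 0"
  then have "y \<noteq> z" by (auto simp: bregman_def)
  define h where "h t = F (z + t *\<^sub>R (y - z)) - t * (F y - F z)" for t
  have "(F has_derivative (\<lambda>h. h \<bullet> grad F z)) (at (z + 0 *\<^sub>R (y - z)))"
    using GDERIV_grad[OF assms(2)] by (simp add: gderiv_def)
  then have "((\<lambda>t. F (z + t *\<^sub>R (y - z))) has_derivative (\<lambda>t. (t *\<^sub>R (y - z)) \<bullet> grad F z)) (at 0)"
    by (rule has_derivative_compose[rotated]) (auto intro!: derivative_eq_intros)
  then have "(h has_derivative (\<lambda>t. (t *\<^sub>R (y - z)) \<bullet> grad F z - t * (F y - F z))) (at 0)"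
    unfolding h_def by (auto intro!: derivative_eq_intros)
  then have "(h has_real_derivative - bregman F y z) (at 0)"
    by (rule has_derivative_imp_has_field_derivative) (simp add: bregman_def algebra_simps)
  then obtain d where "d > 0" and d: "\<And>t. 0 < t \<Longrightarrow> t < d \<Longrightarrow> h 0 < h t"
    using DERIV_pos_inc_right[of h "- bregman F y z" 0] neg by auto
  define t where "t = min (d / 2) (1 / 2)"
  have t: "0 < t" "t < d" "t < 1" using \<open>d > 0\<close> by (auto simp: t_def)
  have "F (t *\<^sub>R y + (1 - t) *\<^sub>R z) < t * F y + (1 - t) * F z"
    using strictly_convex_onD[OF F] assms(3,4) t \<open>y \<noteq> z\<close> by blast
  then have "h t < h 0" by (simp add: h_def algebra_simps)
  then show False using d[OF t(1,2)] by simp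
qed

text \<open>By strict convexity the divergence at the midpoint \<open>?m\<close> is less than half
  of the one at \<open>y\<close>, and it is already nonnegative.\<close>

lemma bregman_pos:
  fixes F :: "'a::euclidean_space \<Rightarrow> real"
  assumes F: "strictly_convex_on X F" and "F differentiable (at z)" and "y \<in> X" "z \<in> X" "y \<noteq> z"
  shows "bregman F y z > 0"
proof -
  let ?m = "(1/2) *\<^sub>R y + (1/2) *\<^sub>R z"
  have "?m \<in> X" using F assms(3,4) by (auto simp: strictly_convex_on_def intro!: convexD)
  then have "bregman F ?m z \<ge> 0" using bregman_nonneg[OF F assms(2)] assms(4) by blast
  moreover have "(?m - z) \<bullet> grad F z = (1/2) * ((y - z) \<bullet> grad F z)"
    by (simp add: algebra_simps)
  moreover have "F ?m < (1/2) * F y + (1/2) * F z"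
    using strictly_convex_onD[OF F assms(3-5), of "1/2"] by simp
  ultimately show ?thesis by (simp add: bregman_def)
qed

text \<open>The gradients at the \<open>p j\<close> enter only through their weighted sum, which is
  the gradient at \<open>q\<close>. This is the Bregman form of the parallel axis identity.\<close>

lemma sum_bregman_eq:
  fixes F :: "'a::real_inner \<Rightarrow> real"
  assumes w: "(\<Sum>j\<in>J. w j) = 1" and q: "grad F q = (\<Sum>j\<in>J. w j *\<^sub>R grad F (p j))"
  shows "(\<Sum>j\<in>J. w j * bregman F x (p j)) = bregman F x q + (\<Sum>j\<in>J. w j * bregman F q (p j))"
proof -
  have "(\<Sum>j\<in>J. w j * bregman F x (p j)) - (\<Sum>j\<in>J. w j * bregman F q (p j))
      = (\<Sum>j\<in>J. w j * (F x - F q) - (x - q) \<bullet> (w j *\<^sub>R grad F (p j)))"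
    by (simp add: bregman_def algebra_simps flip: sum_subtractf)
  also have "\<dots> = bregman F x q"
    by (simp add: sum_subtractf w bregman_def q inner_sum_right flip: sum_distrib_right)
  finally show ?thesis by simp
qed

text \<open>Only the summand \<open>bregman F x q\<close> of the decomposed objective depends on
  \<open>x\<close>, and it is positive away from \<open>q\<close>. Thus \<open>q\<close> is the only
  minimiser and the choice in \<open>arg_min_on\<close> is forced.\<close>

lemma bregman_barycenter_eqI:
  fixes F :: "'a::euclidean_space \<Rightarrow> real"
  assumes F: "strictly_convex_on X F" and "F differentiable (at q)" and "q \<in> X"
    and "(\<Sum>j\<in>UNIV. w j) = 1" and "grad F q = (\<Sum>j\<in>UNIV. w j *\<^sub>R grad F (p j))"
  shows "bregman_barycenter X F w p = q"
proof -
  define obj where "obj x = (\<Sum>j\<in>UNIV. w j * bregman F x (p j))" for x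
  have "obj q < obj x" if "x \<in> X" "x \<noteq> q" for x
    using bregman_pos[OF F assms(2) that(1) \<open>q \<in> X\<close> that(2)]
    unfolding obj_def sum_bregman_eq[OF assms(4,5), of x] by simp
  then have "is_arg_min obj (\<lambda>x. x \<in> X) x \<longleftrightarrow> x = q" for x
    using \<open>q \<in> X\<close> unfolding is_arg_min_def by (metis less_asym)
  then show ?thesis
    by (simp add: bregman_barycenter_def arg_min_on_def arg_min_def flip: obj_def)
qed

section \<open>Transport between the views and their gradients\<close>

theorem theorem1:
  fixes X Y :: "(real^'d) set"
    and F :: "real^'d \<Rightarrow> real"
    and W :: "real^'n^'n"
    and x :: "'n \<Rightarrow> real^'d"
  assumes "open X" and "convex X"
    and "open Y" and "convex Y"
    and "strictly_convex_on X F"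
    and "\<forall>z\<in>X. F differentiable (at z)"
    and "\<exists>G. homeomorphism X Y (grad F) G"
    and "\<forall>i j. W $ i $ j > 0"
    and "\<forall>i. (\<Sum>j\<in>UNIV. W $ i $ j) = 1"
    and "\<forall>i. x i \<in> X"
  shows "(\<exists>!\<pi>. stationary_distribution W \<pi>) \<and>
    (\<forall>\<pi>. stationary_distribution W \<pi> \<longrightarrow>
      (let xbar = inv_into X (grad F) (\<Sum>j\<in>UNIV. \<pi> $ j *\<^sub>R grad F (x j))
       in xbar \<in> X \<and> (\<forall>i. (\<lambda>k. view X F W x k i) \<longlonglongrightarrow> xbar)))"
proof -
  obtain G where G: "homeomorphism X Y (grad F) G" using assms(7) by blast
  then have grad_in: "grad F z \<in> Y" if "z \<in> X" for z
    using that by (auto simp: homeomorphism_def)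
  have G_in: "G y \<in> X" and grad_G: "grad F (G y) = y" if "y \<in> Y" for y
    using G that by (auto simp: homeomorphism_def)
  have G_grad: "G (grad F z) = z" if "z \<in> X" for z
    using G that by (simp add: homeomorphism_def)
  have view_in: "view X F W x k i \<in> X" and
    view_Suc: "grad F (view X F W x (Suc k) i) = (\<Sum>j\<in>UNIV. W $ i $ j *\<^sub>R grad F (view X F W x k j))"
    for k i
  proof -
    \<comment> \<open>Membership and recursion are proved together: views in \<open>X\<close> have
      gradients in the convex set \<open>Y\<close>, so the weighted mean \<open>s\<close> lies in
      \<open>Y\<close> and \<open>G s\<close> is a point of \<open>X\<close> with gradient
      \<open>s\<close>, hence the barycenter.\<close>
    have step: "view X F W x (Suc k) i \<in> X \<and>
      grad F (view X F W x (Suc k) i) = (\<Sum>j\<in>UNIV. W $ i $ j *\<^sub>R grad F (view X F W x k j))"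
      if "\<And>j. view X F W x k j \<in> X" for k i
    proof -
      define s where "s = (\<Sum>j\<in>UNIV. W $ i $ j *\<^sub>R grad F (view X F W x k j))"
      have "s \<in> Y"
        unfolding s_def using assms(4,8,9) that grad_in
        by (intro convex_sum) (auto intro: less_imp_le)
      then have "view X F W x (Suc k) i = G s"
        using assms(5,6,9) G_in grad_G by (auto simp: s_def intro!: bregman_barycenter_eqI)
      then show ?thesis using G_in grad_G \<open>s \<in> Y\<close> by (simp add: s_def del: view.simps)
    qed
    have all: "\<forall>i. view X F W x k i \<in> X" for k
    proof (induction k)
      case (Suc k)
      then show ?case using step by blast
    qed (use assms(10) in simp)
    show "view X F W x k i \<in> X" using all by blast
    show "grad F (view X F W x (Suc k) i) = (\<Sum>j\<in>UNIV. W $ i $ j *\<^sub>R grad F (view X F W x k j))"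
      using step all by blast
  qed
  have "let xbar = inv_into X (grad F) (\<Sum>j\<in>UNIV. \<pi> $ j *\<^sub>R grad F (x j))
       in xbar \<in> X \<and> (\<forall>i. (\<lambda>k. view X F W x k i) \<longlonglongrightarrow> xbar)"
    if \<pi>: "stationary_distribution W \<pi>" for \<pi>
  proof -
    define ybar where "ybar = (\<Sum>j\<in>UNIV. \<pi> $ j *\<^sub>R grad F (x j))"
    have "ybar \<in> Y"
      unfolding ybar_def using \<pi> assms(4,10) grad_in
      by (intro convex_sum) (auto simp: stationary_distribution_def intro: less_imp_le)
    \<comment> \<open>Replacing \<open>inv_into\<close> by the inverse \<open>G\<close> makes
      continuity on \<open>Y\<close> available for the passage to the limit.\<close>
    have "inv_into X (grad F) ybar = G ybar"
      using G_in grad_G G_grad \<open>ybar \<in> Y\<close> by (intro inv_into_f_eq inj_on_inverseI[of X G]) auto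
    moreover have "(\<lambda>k. view X F W x k i) \<longlonglongrightarrow> G ybar" for i
    proof -
      have lim: "(\<lambda>k. grad F (view X F W x k i)) \<longlonglongrightarrow> ybar"
        using row_stochastic_iteration_tendsto[of W "\<lambda>k i. grad F (view X F W x k i)" \<pi> i]
          assms(8,9) view_Suc \<pi> by (simp add: ybar_def)
      have "(\<lambda>k. G (grad F (view X F W x k i))) \<longlonglongrightarrow> G ybar"
        using G by (intro continuous_on_tendsto_compose[OF _ lim \<open>ybar \<in> Y\<close>])
          (auto simp: homeomorphism_def view_in grad_in)
      then show ?thesis by (simp add: G_grad view_in)
    qed
    ultimately show ?thesis using G_in \<open>ybar \<in> Y\<close> by (simp add: ybar_def)
  qed
  then show ?thesis using stationary_distribution_ex1[of W] assms(8,9) by blast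
qed

end
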